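(* Let $n\in\mathbb{N}$ and $a,b\in\mathbb{C}$ be such that $a+b\notin\{1,1-\frac1n,1-\frac2n,\dots,\frac1n\}$. Then the polynomial $q_n=p_{n,(a,b)}$ solves $$q_n=p_{n,(a,a+b)}\boxtimes_n\left(e_{\boxtimes_n}\boxplus_n q_n\right),\qquad e_{\boxtimes_n}(z)=(z-1)^n,$$ where $\boxplus_n,\boxtimes_n$ are the finite free additive and multiplicative convolutions.
   Context: Rising factorial: $(x)_0=1$, $(x)_k=x(x+1)\cdots(x+k-1)$. For $n\in\mathbb{N}$ every complex polynomial $p$ of degree at most $n$ (including the zero polynomial) is written uniquely as $p(z)=\sum_{k=0}^n(-1)^k\binom nk\widetilde{\mathsf e}_k^{(n)}(p)z^{n-k}$. For polynomials $p,q$ of degree at most $n$, $p\boxplus_nq$ and $p\boxtimes_nq$ are the polynomials of degree at most $n$ with $$\widetilde{\mathsf e}_k^{(n)}(p\boxplus_nq)=\sum_{j=0}^k\binom kj\widetilde{\mathsf e}_j^{(n)}(p)\widetilde{\mathsf e}_{k-j}^{(n)}(q),\qquad \widetilde{\mathsf e}_k^{(n)}(p\boxtimes_nq)=\widetilde{\mathsf e}_k^{(n)}(p)\widetilde{\mathsf e}_k^{(n)}(q),\qquad k=0,\dots,n.$$ Definition of $p_{n,(a,b)}$: for $a\in\mathbb{C}$ and $b\in\mathbb{C}\setminus\{1,1-\frac1n,\dots,\frac1n\}$, $p_{n,(a,b)}$ is the monic polynomial of degree $n$ with $\widetilde{\mathsf e}_k^{(n)}(p_{n,(a,b)})=(-1)^k\frac{(-an)_k}{((b-1)n)_k}$,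 $k=0,\dots,n$. For $b=b_i:=1-\frac{i-1}{n}$ with $i\in\{1,\dots,n\}$, $p_{n,(a,b_i)}$ is the monic polynomial of degree $n-i$ given, when $(-an)_i\ne0$, by $p_{n,(a,b_i)}(z)=\lim_{b\to b_i}\frac{p_{n,(a,b)}(z)}{(-1)^i\binom ni\widetilde{\mathsf e}_i^{(n)}(p_{n,(a,b)})}$ (the coefficients of this limit are polynomial functions of $a$, and this extends the definition to all $a\in\mathbb{C}$). *)

theory Defs
  imports "HOL-Analysis.Analysis" "HOL-Computational_Algebra.Polynomial"
begin

section \<open>Normalized coefficients and finite free convolutions\<close>

definition ecoeff :: "nat \<Rightarrow> nat \<Rightarrow> complex poly \<Rightarrow> complex" where
  "ecoeff n k p = (- 1) ^ k * coeff p (n - k) / of_nat (n choose k)"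

definition poly_of_ecoeffs :: "nat \<Rightarrow> (nat \<Rightarrow> complex) \<Rightarrow> complex poly" where
  "poly_of_ecoeffs n e = (\<Sum>k\<le>n. monom ((- 1) ^ k * of_nat (n choose k) * e k) (n - k))"

lemma degree_poly_of_ecoeffs: "degree (poly_of_ecoeffs n e) \<le> n"
  unfolding poly_of_ecoeffs_def
  by (intro degree_sum_le) (auto intro: order.trans[OF degree_monom_le])

lemma coeff_poly_of_ecoeffs:
  assumes "k \<le> n"
  shows "coeff (poly_of_ecoeffs n e) (n - k) = (- 1) ^ k * of_nat (n choose k) * e k"
proof -
  have "coeff (poly_of_ecoeffs n e) (n - k) =
          (\<Sum>j\<le>n. if j = k then (- 1) ^ j * of_nat (n choose j) * e j else 0)"
    unfolding poly_of_ecoeffs_def coeff_sum using assms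
    by (intro sum.cong refl) auto
  then show ?thesis
    using assms by simp
qed

lemma ecoeff_poly_of_ecoeffs:
  assumes "k \<le> n"
  shows "ecoeff n k (poly_of_ecoeffs n e) = e k"
proof -
  have "n choose k \<noteq> 0"
    using assms by simp
  then show ?thesis
    by (simp add: ecoeff_def coeff_poly_of_ecoeffs[OF assms] flip: power_add mult.assoc)
qed

lemma poly_of_ecoeffs_ecoeff:
  assumes "degree p \<le> n"
  shows "poly_of_ecoeffs n (\<lambda>k. ecoeff n k p) = p"
proof (rule poly_eqI)
  fix m
  show "coeff (poly_of_ecoeffs n (\<lambda>k. ecoeff n k p)) m = coeff p m"
  proof (cases "m \<le> n")
    case True
    have "n choose (n - m) \<noteq> 0"
      using True by simp
    then show ?thesis
      using True coeff_poly_of_ecoeffs[of "n - m" n "\<lambda>k. ecoeff n k p"]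
      by (simp add: ecoeff_def flip: power_add mult.assoc)
  next
    case False
    then show ?thesis
      using assms degree_poly_of_ecoeffs[of n "\<lambda>k. ecoeff n k p"] by (simp add: coeff_eq_0)
  qed
qed

text \<open>Both convolutions are only meaningful for arguments of degree at most \<^term>\<open>n\<close>.\<close>

definition ff_add_conv :: "nat \<Rightarrow> complex poly \<Rightarrow> complex poly \<Rightarrow> complex poly" where
  "ff_add_conv n p q = poly_of_ecoeffs n
     (\<lambda>k. \<Sum>j\<le>k. of_nat (k choose j) * ecoeff n j p * ecoeff n (k - j) q)"

definition ff_mult_conv :: "nat \<Rightarrow> complex poly \<Rightarrow> complex poly \<Rightarrow> complex poly" where
  "ff_mult_conv n p q = poly_of_ecoeffs n (\<lambda>k. ecoeff n k p * ecoeff n k q)"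

definition ff_mult_unit :: "nat \<Rightarrow> complex poly" where
  "ff_mult_unit n = [:- 1, 1:] ^ n"


section \<open>The hypergeometric polynomials\<close>

definition exceptional :: "nat \<Rightarrow> complex set" where
  "exceptional n = {1 - of_nat j / of_nat n | j. j < n}"

lemma pochhammer_exceptional:
  assumes "k \<le> n" "b \<notin> exceptional n"
  shows "pochhammer ((b - 1) * of_nat n) k \<noteq> 0"
proof
  assume "pochhammer ((b - 1) * of_nat n) k = 0"
  then obtain j where j: "j < k" "(b - 1) * of_nat n = - of_nat j"
    unfolding pochhammer_eq_0_iff by blast
  then have "b = 1 - of_nat j / of_nat n"
    using assms(1) by (auto simp: field_simps eq_neg_iff_add_eq_0)
  then show False
    using assms j unfolding exceptional_def by auto
qed

text \<open>This is only meaningful for \<^term>\<open>b \<notin> exceptional n\<close>.\<close>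

definition hyp_poly_regular :: "nat \<Rightarrow> complex \<Rightarrow> complex \<Rightarrow> complex poly" where
  "hyp_poly_regular n a b = poly_of_ecoeffs n
     (\<lambda>k. (- 1) ^ k * pochhammer (- a * of_nat n) k / pochhammer ((b - 1) * of_nat n) k)"

lemma hyp_poly_regular_monic:
  "degree (hyp_poly_regular n a b) = n" "lead_coeff (hyp_poly_regular n a b) = 1"
proof -
  have "coeff (hyp_poly_regular n a b) n = 1"
    using coeff_poly_of_ecoeffs[of 0 n] by (simp add: hyp_poly_regular_def)
  moreover have "degree (hyp_poly_regular n a b) \<le> n"
    unfolding hyp_poly_regular_def by (rule degree_poly_of_ecoeffs)
  ultimately show "degree (hyp_poly_regular n a b) = n"
      "lead_coeff (hyp_poly_regular n a b) = 1"
    by (metis le_antisym le_degree zero_neq_one)+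
qed

text \<open>
  At the exceptional parameter \<^term>\<open>b\<^sub>i = 1 - (of_nat i - 1) / of_nat n\<close> the polynomials are
  given by a limit when \<open>(-a n)\<^sub>i \<noteq> 0\<close>, and by polynomial continuation of the coefficients
  in \<^term>\<open>a\<close> for the finitely many other \<^term>\<open>a\<close>. The family as a whole is characterised
  by these two requirements.
\<close>

definition is_exceptional_family :: "nat \<Rightarrow> nat \<Rightarrow> (complex \<Rightarrow> complex poly) \<Rightarrow> bool" where
  "is_exceptional_family n i F \<longleftrightarrow>
     (\<forall>m. \<exists>c. \<forall>a. coeff (F a) m = poly c a) \<and>
     (\<forall>a. pochhammer (- a * of_nat n) i \<noteq> 0 \<longrightarrow>
        (\<forall>z. ((\<lambda>b. poly (hyp_poly_regular n a b) z /
                   ((- 1) ^ i * of_nat (n choose i) * ecoeff n i (hyp_poly_regular n a b)))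
              \<longlongrightarrow> poly (F a) z) (at (1 - (of_nat i - 1) / of_nat n))))"

definition hyp_poly_exceptional :: "nat \<Rightarrow> nat \<Rightarrow> complex \<Rightarrow> complex poly" where
  "hyp_poly_exceptional n i = (THE F. is_exceptional_family n i F)"

definition hyp_poly :: "nat \<Rightarrow> complex \<Rightarrow> complex \<Rightarrow> complex poly" where
  "hyp_poly n a b =
     (if b \<in> exceptional n
      then hyp_poly_exceptional n (THE i. i \<in> {1..n} \<and> b = 1 - (of_nat i - 1) / of_nat n) a
      else hyp_poly_regular n a b)"


subsection \<open>Well-definedness at the exceptional parameters\<close>

lemma exceptional_index_unique:
  assumes "n \<ge> 1" "i \<in> {1..n}"
  shows "(THE j. j \<in> {1..n} \<and> 1 - (of_nat i - 1) / of_nat n = (1 - (of_nat j - 1) / of_nat n :: complex)) = i"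
  using assms by (intro the_equality) (auto simp: field_simps)

lemma exceptional_eq:
  assumes "n \<ge> 1"
  shows "exceptional n = (\<lambda>i. 1 - (of_nat i - 1) / of_nat n) ` {1..n}"
proof (intro equalityI subsetI)
  fix b assume "b \<in> exceptional n"
  then obtain j where "j < n" "b = 1 - of_nat j / of_nat n"
    unfolding exceptional_def by blast
  then show "b \<in> (\<lambda>i. 1 - (of_nat i - 1) / of_nat n) ` {1..n}"
    by (intro image_eqI[of _ _ "Suc j"]) auto
next
  fix b :: complex assume "b \<in> (\<lambda>i. 1 - (of_nat i - 1) / of_nat n) ` {1..n}"
  then obtain i where "i \<in> {1..n}" "b = 1 - (of_nat i - 1) / of_nat n"
    by blast
  then show "b \<in> exceptional n"
    unfolding exceptional_def by (intro CollectI exI[of _ "i - 1"]) (auto simp: of_nat_diff)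
qed

lemma is_exceptional_family_unique:
  assumes n: "n \<ge> 1" and F: "is_exceptional_family n i F" and G: "is_exceptional_family n i G"
  shows "F = G"
proof -
  have agree: "F a = G a" if a: "pochhammer (- a * of_nat n) i \<noteq> 0" for a
  proof -
    have "poly (F a) z = poly (G a) z" for z
      using F G a unfolding is_exceptional_family_def
      by (blast intro: tendsto_unique[OF at_neq_bot])
    then show ?thesis
      by (intro poly_eqI_degree_lead_coeff poly_eq_poly_eq_iff[THEN iffD1]) auto
  qed
  have "{a :: complex. pochhammer (- a * of_nat n) i = 0} \<subseteq> (\<lambda>j. of_nat j / of_nat n) ` {..<i}"
  proof
    fix a :: complex assume "a \<in> {a. pochhammer (- a * of_nat n) i = 0}"
    then obtain j where "j < i" "- a * of_nat n = - of_nat j"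
      unfolding mem_Collect_eq pochhammer_eq_0_iff by blast
    then show "a \<in> (\<lambda>j. of_nat j / of_nat n) ` {..<i}"
      using n by (intro image_eqI[of _ _ j]) (auto simp: field_simps)
  qed
  then have fin: "finite {a :: complex. pochhammer (- a * of_nat n) i = 0}"
    by (rule finite_subset) auto
  show ?thesis
  proof (intro ext poly_eqI)
    fix a m
    obtain c d where c: "\<And>a. coeff (F a) m = poly c a" and d: "\<And>a. coeff (G a) m = poly d a"
      using F G unfolding is_exceptional_family_def by metis
    have "UNIV - {a. pochhammer (- a * of_nat n) i = 0} \<subseteq> {a. poly (c - d) a = 0}"
      using agree by (auto simp flip: c d)
    then have "infinite {a. poly (c - d) a = 0}"
      using fin infinite_UNIV_char_0 by (meson Diff_infinite_finite finite_subset)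
    then have "c - d = 0"
      using poly_roots_finite by blast
    then show "coeff (F a) m = coeff (G a) m"
      by (simp add: c d)
  qed
qed

definition exceptional_family :: "nat \<Rightarrow> nat \<Rightarrow> complex \<Rightarrow> complex poly" where
  "exceptional_family n i a = (\<Sum>k=i..n. monom
     (of_nat (n choose k) / of_nat (n choose i) *
        pochhammer (of_nat i - a * of_nat n) (k - i) / fact (k - i)) (n - k))"

lemma tendsto_pochhammer:
  fixes f :: "'a \<Rightarrow> complex"
  assumes "(f \<longlongrightarrow> l) F"
  shows "((\<lambda>x. pochhammer (f x) k) \<longlongrightarrow> pochhammer l k) F"
  unfolding pochhammer_prod by (intro tendsto_intros assms)

lemma is_exceptional_family_exceptional_family:
  assumes n: "n \<ge> 1" and i: "i \<in> {1..n}"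
  shows "is_exceptional_family n i (exceptional_family n i)"
  unfolding is_exceptional_family_def
proof (intro conjI allI impI)
  fix m
  define c where "c = (\<Sum>k=i..n. if n - k = m then
     smult (of_nat (n choose k) / of_nat (n choose i) / fact (k - i))
       (\<Prod>j<k - i. [:of_nat i + of_nat j, - of_nat n :: complex:]) else 0)"
  have "coeff (exceptional_family n i a) m = poly c a" for a
    unfolding exceptional_family_def c_def coeff_sum poly_sum
    by (intro sum.cong refl)
       (auto simp: poly_prod pochhammer_prod algebra_simps atLeast0LessThan)
  then show "\<exists>c. \<forall>a. coeff (exceptional_family n i a) m = poly c a"
    by blast
next
  fix a z :: complex
  assume a: "pochhammer (- a * of_nat n) i \<noteq> 0"
  define bi :: complex where "bi = 1 - (of_nat i - 1) / of_nat n"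
  define P where "P = (\<lambda>k. pochhammer (- a * of_nat n) k)"
  define Q where "Q = (\<lambda>(b::complex) k. pochhammer ((b - 1) * of_nat n) k)"
  have bi: "(bi - 1) * of_nat n = 1 - of_nat i"
    using n by (simp add: bi_def)
  have binom: "n choose i \<noteq> 0"
    using i by simp
  have "finite (exceptional n)"
    using n by (simp add: exceptional_eq)
  then have "eventually (\<lambda>b. \<forall>e\<in>exceptional n. b \<noteq> e) (at bi)"
    by (intro eventually_ball_finite ballI eventually_neq_at_within)
  then have ev: "eventually (\<lambda>b. b \<notin> exceptional n) (at bi)"
    by (auto elim!: eventually_mono)
  have summand: "((\<lambda>b. P k / Q b k / (P i / Q b i)) \<longlongrightarrow>
      (if k < i then 0 else pochhammer (of_nat i - a * of_nat n) (k - i) / fact (k - i))) (at bi)"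
    if k: "k \<le> n" for k
  proof (cases "k < i")
    case True
    have nz: "Q bi k \<noteq> 0"
    proof
      assume "Q bi k = 0"
      then obtain j where "j < k" "1 - of_nat i = - (of_nat j :: complex)"
        unfolding Q_def bi pochhammer_eq_0_iff by blast
      then have "of_nat (1 + j) = (of_nat i :: complex)"
        by (simp add: algebra_simps)
      then have "1 + j = i"
        unfolding of_nat_eq_iff .
      then show False
        using True \<open>j < k\<close> by simp
    qed
    have z: "Q bi i = 0"
    proof -
      have "1 - of_nat i = - (of_nat (i - 1) :: complex)" "i - 1 < i"
        using i by (auto simp: of_nat_diff)
      then show ?thesis
        unfolding Q_def bi pochhammer_eq_0_iff by blast
    qed
    have "((\<lambda>b. P k / Q b k / P i * Q b i) \<longlongrightarrow> P k / Q bi k / P i * Q bi i) (at bi)"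
      using nz a unfolding Q_def P_def
      by (intro tendsto_intros tendsto_pochhammer) auto
    then show ?thesis
      using True z by simp
  next
    case False
    have lim: "((\<lambda>b. pochhammer (of_nat i - a * of_nat n) (k - i) /
              pochhammer ((b - 1) * of_nat n + of_nat i) (k - i)) \<longlongrightarrow>
            pochhammer (of_nat i - a * of_nat n) (k - i) /
              pochhammer ((bi - 1) * of_nat n + of_nat i) (k - i)) (at bi)"
      by (intro tendsto_intros tendsto_pochhammer) (auto simp: bi simp flip: pochhammer_fact)
    have "eventually (\<lambda>b. pochhammer (of_nat i - a * of_nat n) (k - i) /
              pochhammer ((b - 1) * of_nat n + of_nat i) (k - i) =
            P k / Q b k / (P i / Q b i)) (at bi)"
      using ev
    proof eventually_elim
      case (elim b)
      have "Q b k \<noteq> 0" "Q b i \<noteq> 0"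
        using elim i k by (auto simp: Q_def pochhammer_exceptional)
      moreover have "Q b k = Q b i * pochhammer ((b - 1) * of_nat n + of_nat i) (k - i)"
        using False by (simp add: Q_def pochhammer_product)
      moreover have "P k = P i * pochhammer (of_nat i - a * of_nat n) (k - i)"
        using False pochhammer_product[of i k "- a * of_nat n"] by (simp add: P_def)
      ultimately show ?case
        using a by (simp add: P_def)
    qed
    from Lim_transform_eventually[OF lim this] show ?thesis
      using False by (simp add: bi pochhammer_fact)
  qed
  have eq: "poly (hyp_poly_regular n a b) z /
        ((- 1) ^ i * of_nat (n choose i) * ecoeff n i (hyp_poly_regular n a b)) =
      (\<Sum>k\<le>n. of_nat (n choose k) / of_nat (n choose i) * (P k / Q b k / (P i / Q b i)) * z ^ (n - k))"
    for b
  proof -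
    have "(- 1) ^ i * of_nat (n choose i) * ecoeff n i (hyp_poly_regular n a b) =
        of_nat (n choose i) * (P i / Q b i)"
      using i by (simp add: hyp_poly_regular_def ecoeff_poly_of_ecoeffs P_def Q_def flip: power_add mult.assoc)
    moreover have "poly (hyp_poly_regular n a b) z =
        (\<Sum>k\<le>n. of_nat (n choose k) * (P k / Q b k) * z ^ (n - k))"
      unfolding hyp_poly_regular_def poly_of_ecoeffs_def poly_sum poly_monom P_def Q_def
      by (intro sum.cong refl) (simp flip: power_add mult.assoc)
    ultimately show ?thesis
      by (simp only: sum_divide_distrib) (intro sum.cong refl, simp add: mult_ac)
  qed
  have "((\<lambda>b. \<Sum>k\<le>n. of_nat (n choose k) / of_nat (n choose i) * (P k / Q b k / (P i / Q b i)) * z ^ (n - k))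
     \<longlongrightarrow> (\<Sum>k\<le>n. of_nat (n choose k) / of_nat (n choose i) *
          (if k < i then 0 else pochhammer (of_nat i - a * of_nat n) (k - i) / fact (k - i)) * z ^ (n - k)))
     (at bi)"
    by (intro tendsto_intros summand) auto
  also have "(\<Sum>k\<le>n. of_nat (n choose k) / of_nat (n choose i) *
          (if k < i then 0 else pochhammer (of_nat i - a * of_nat n) (k - i) / fact (k - i)) * z ^ (n - k)) =
      poly (exceptional_family n i a) z"
    unfolding exceptional_family_def poly_sum poly_monom
    by (rule sum.mono_neutral_cong_right) auto
  finally show "((\<lambda>b. poly (hyp_poly_regular n a b) z /
        ((- 1) ^ i * of_nat (n choose i) * ecoeff n i (hyp_poly_regular n a b)))
      \<longlongrightarrow> poly (exceptional_family n i a) z) (at (1 - (of_nat i - 1) / of_nat n))"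
    unfolding eq bi_def .
qed

lemma hyp_poly_exceptional_eq:
  assumes "n \<ge> 1" "i \<in> {1..n}"
  shows "hyp_poly_exceptional n i = exceptional_family n i"
  unfolding hyp_poly_exceptional_def
  using is_exceptional_family_exceptional_family[OF assms] is_exceptional_family_unique[OF assms(1)]
  by (intro the_equality)

lemma hyp_poly_exceptional_monic:
  assumes "n \<ge> 1" "i \<in> {1..n}"
  shows "degree (hyp_poly_exceptional n i a) = n - i" "lead_coeff (hyp_poly_exceptional n i a) = 1"
proof -
  have "n choose i \<noteq> 0"
    using assms by simp
  have "coeff (hyp_poly_exceptional n i a) (n - i) =
      (\<Sum>k=i..n. if k = i then 1 else 0)"
    unfolding hyp_poly_exceptional_eq[OF assms] exceptional_family_def coeff_sum
    using assms \<open>n choose i \<noteq> 0\<close> by (intro sum.cong refl) auto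
  then have 1: "coeff (hyp_poly_exceptional n i a) (n - i) = 1"
    using assms by simp
  have "degree (hyp_poly_exceptional n i a) \<le> n - i"
    unfolding hyp_poly_exceptional_eq[OF assms] exceptional_family_def
    by (intro degree_sum_le) (auto intro: order.trans[OF degree_monom_le])
  with 1 show "degree (hyp_poly_exceptional n i a) = n - i"
      "lead_coeff (hyp_poly_exceptional n i a) = 1"
    by (metis le_antisym le_degree zero_neq_one)+
qed

end

theory Submission
  imports Defs "HOL-Computational_Algebra.Formal_Power_Series"
begin

text \<open>
  All normalized coefficients of \<open>(z - 1)\<^sup>n\<close> are \<open>1\<close>, so adding it by \<open>\<boxplus>\<^sub>n\<close> replaces the
  normalized coefficients of \<open>q\<close> by their binomial transform. Put \<open>x = - a n\<close> and
  \<open>y = (b - 1) n\<close>. For regular \<open>b\<close>, the Chu--Vandermonde identity evaluates the binomial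
  transform as \<open>(y - x)\<^sub>k / (y)\<^sub>k\<close>, and multiplying by the coefficient
  \<open>(-1)\<^sup>k (x)\<^sub>k / (y - x)\<^sub>k\<close> of \<open>p\<^bsub>n,(a,a+b)\<^esub>\<close> gives back \<open>(-1)\<^sup>k (x)\<^sub>k / (y)\<^sub>k\<close>.
  At the exceptional \<open>b\<^sub>i\<close>, where \<open>y = 1 - i\<close>, the coefficients vanish below \<open>i\<close>, and after
  an index shift by \<open>i\<close> the same identity applies with \<open>x + i\<close> and \<open>i + 1\<close> in place
  of \<open>x\<close> and \<open>y\<close>.
\<close>

lemma poly_of_ecoeffs_cong:
  assumes "\<And>k. k \<le> n \<Longrightarrow> e k = f k"
  shows "poly_of_ecoeffs n e = poly_of_ecoeffs n f"
  unfolding poly_of_ecoeffs_def using assms by (intro sum.cong refl) auto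

lemma ecoeff_ff_mult_unit:
  assumes "k \<le> n"
  shows "ecoeff n k (ff_mult_unit n) = 1"
proof -
  have "n choose k \<noteq> 0" "n choose (n - k) = n choose k"
    using assms by (auto simp flip: binomial_symmetric)
  then show ?thesis
    using assms
    by (simp add: ecoeff_def ff_mult_unit_def coeff_linear_poly_power flip: power_add mult_2)
qed

lemma ff_add_conv_unit:
  "ff_add_conv n (ff_mult_unit n) (poly_of_ecoeffs n e) =
    poly_of_ecoeffs n (\<lambda>k. \<Sum>j\<le>k. of_nat (k choose j) * e j)"
  unfolding ff_add_conv_def
proof (rule poly_of_ecoeffs_cong)
  fix k assume k: "k \<le> n"
  have "(\<Sum>j\<le>k. of_nat (k choose j) * ecoeff n j (ff_mult_unit n) *
            ecoeff n (k - j) (poly_of_ecoeffs n e)) =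
        (\<Sum>j\<le>k. of_nat (k choose j) * e (k - j))"
    using k by (intro sum.cong refl) (simp add: ecoeff_ff_mult_unit ecoeff_poly_of_ecoeffs)
  also have "\<dots> = (\<Sum>j\<le>k. of_nat (k choose j) * e j)"
    by (rule sum.reindex_bij_witness[of _ "\<lambda>j. k - j" "\<lambda>j. k - j"])
       (auto simp flip: binomial_symmetric)
  finally show "(\<Sum>j\<le>k. of_nat (k choose j) * ecoeff n j (ff_mult_unit n) *
      ecoeff n (k - j) (poly_of_ecoeffs n e)) = (\<Sum>j\<le>k. of_nat (k choose j) * e j)" .
qed

lemma ff_mult_conv_poly_of_ecoeffs:
  "ff_mult_conv n (poly_of_ecoeffs n e) (poly_of_ecoeffs n f) =
    poly_of_ecoeffs n (\<lambda>k. e k * f k)"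
  unfolding ff_mult_conv_def
  by (rule poly_of_ecoeffs_cong) (simp add: ecoeff_poly_of_ecoeffs)

text \<open>Turns the parameter -k of a terminating hypergeometric sum into the binomial
  coefficients of a binomial transform.\<close>

lemma pochhammer_minus_of_nat:
  assumes "j \<le> k"
  shows "pochhammer (- of_nat k :: 'a :: field_char_0) j =
    (- 1) ^ j * fact j * of_nat (k choose j)"
  by (simp add: binomial_gbinomial gbinomial_pochhammer flip: power_add mult_2)

text \<open>This is Chu--Vandermonde for 2F1(-k, x; y; 1): the factor j! from (-k)_j cancels the j!
  in the denominator of the series.\<close>

lemma binomial_transform_pochhammer_quotient:
  fixes x y :: "'a :: field_char_0"
  assumes "pochhammer y k \<noteq> 0"
  shows "(\<Sum>j\<le>k. of_nat (k choose j) * ((- 1) ^ j * pochhammer x j / pochhammer y j)) =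
    pochhammer (y - x) k / pochhammer y k"
proof -
  have "\<forall>j\<in>{0..<k}. y \<noteq> - of_nat j"
    using assms unfolding pochhammer_eq_0_iff by auto
  from Vandermonde_pochhammer[OF this, of x]
  show ?thesis
    by (simp add: pochhammer_minus_of_nat atMost_atLeast0 mult_ac)
qed

lemma binomial_transform_shifted_pochhammer:
  fixes x :: "'a :: field_char_0"
  assumes "i \<le> k"
  shows "(\<Sum>j\<le>k. of_nat (k choose j) *
      (if j < i then 0 else (- 1) ^ j * pochhammer (of_nat i + x) (j - i) / fact (j - i))) =
    (- 1) ^ i * pochhammer (1 - x) (k - i) / fact (k - i)"
proof -
  define m where "m = k - i"
  have k: "k = i + m"
    using assms by (simp add: m_def)
  \<comment> \<open>Splits (1)_{i+l} = (i+l)! after its first i factors; this is how the lower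
    parameter i + 1 arises.\<close>
  have rising: "fact i * pochhammer (of_nat i + 1) l = (fact (i + l) :: 'a)" for l
    using pochhammer_product'[of "1 :: 'a" i l] by (simp add: pochhammer_fact add.commute)
  have nz: "pochhammer (of_nat i + 1 :: 'a) l \<noteq> 0" for l
    using rising[of l] by (metis fact_nonzero mult_zero_right)
  have choose: "of_nat (k choose (i + l)) / fact l =
      of_nat (k choose i) * of_nat (m choose l) / pochhammer (of_nat i + 1 :: 'a) l"
    if "l \<le> m" for l
  proof -
    \<comment> \<open>Counting i-subsets inside (i+l)-subsets isolates the l-independent factor
      \<open>k choose i\<close>.\<close>
    have "(k choose (i + l)) * ((i + l) choose i) = (k choose i) * (m choose l)"
      using that choose_mult[of i "i + l" k] by (simp add: k)
    then have "(of_nat (k choose (i + l)) :: 'a) * of_nat ((i + l) choose i) =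
        of_nat (k choose i) * of_nat (m choose l)"
      by (metis of_nat_mult)
    moreover have "(of_nat ((i + l) choose i) :: 'a) = pochhammer (of_nat i + 1) l / fact l"
      by (simp add: binomial_fact flip: rising)
    ultimately show ?thesis
      using nz[of l] by (simp add: field_simps)
  qed
  have "(\<Sum>j\<le>k. of_nat (k choose j) *
      (if j < i then 0 else (- 1) ^ j * pochhammer (of_nat i + x) (j - i) / fact (j - i))) =
    (\<Sum>j\<in>{i..k}. of_nat (k choose j) *
      ((- 1) ^ j * pochhammer (of_nat i + x) (j - i) / fact (j - i)))"
    by (rule sum.mono_neutral_cong_right) auto
  also have "\<dots> = (\<Sum>l\<le>m. of_nat (k choose (i + l)) / fact l *
      ((- 1) ^ (i + l) * pochhammer (of_nat i + x) l))"
    by (rule sum.reindex_bij_witness[of _ "\<lambda>l. i + l" "\<lambda>j. j - i"]) (auto simp: k)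
  also have "\<dots> = (\<Sum>l\<le>m. (- 1) ^ i * of_nat (k choose i) * (of_nat (m choose l) *
      ((- 1) ^ l * pochhammer (of_nat i + x) l / pochhammer (of_nat i + 1) l)))"
    by (intro sum.cong refl) (simp add: choose power_add)
  also have "\<dots> = (- 1) ^ i * of_nat (k choose i) *
      (pochhammer (1 - x) m / pochhammer (of_nat i + 1) m)"
    unfolding sum_distrib_left[symmetric] binomial_transform_pochhammer_quotient[OF nz] by simp
  \<comment> \<open>The numerator (i+1)_m cancels the denominator left by Chu--Vandermonde, so only
    1/m! remains.\<close>
  also have "of_nat (k choose i) = (pochhammer (of_nat i + 1) m / fact m :: 'a)"
    by (simp add: k binomial_fact flip: rising)
  finally show ?thesis
    using nz[of m] by (simp add: m_def)
qed

text \<open>The sign (-1)^k cancels the one built into \<open>poly_of_ecoeffs\<close>; the zeros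
  below i account for the drop of the degree to n - i.\<close>

lemma exceptional_family_eq_poly_of_ecoeffs:
  assumes "i \<le> n"
  shows "exceptional_family n i a = poly_of_ecoeffs n (\<lambda>k. (if k < i then 0
    else (- 1) ^ k * pochhammer (of_nat i + - a * of_nat n) (k - i) / fact (k - i)) /
      of_nat (n choose i))"
  unfolding exceptional_family_def poly_of_ecoeffs_def
  by (rule sum.mono_neutral_cong_left) (auto simp: mult_ac)

lemma hyp_poly_at_exceptional:
  assumes "n \<ge> 1" "i \<in> {1..n}"
  shows "hyp_poly n a (1 - (of_nat i - 1) / of_nat n) = exceptional_family n i a"
proof -
  have "1 - (of_nat i - 1) / of_nat n \<in> exceptional n"
    using assms by (simp add: exceptional_eq)
  then show ?thesis
    unfolding hyp_poly_def
    by (simp only: if_True exceptional_index_unique[OF assms] hyp_poly_exceptional_eq[OF assms])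
qed

text \<open>The first i factors run from 1 - i - x up to -x; negated and reversed they form (x)_i.
  The remaining factors start at 1 - x.\<close>

lemma pochhammer_reflect_split:
  fixes x :: "'a :: comm_ring_1"
  assumes "i \<le> k"
  shows "pochhammer (1 - of_nat i - x) k =
    (- 1) ^ i * pochhammer x i * pochhammer (1 - x) (k - i)"
proof -
  have "pochhammer (1 - of_nat i - x) i = (- 1) ^ i * pochhammer x i"
    using pochhammer_minus'[of "- x" i] by (simp add: algebra_simps)
  then show ?thesis
    using pochhammer_product[OF assms, of "1 - of_nat i - x"] by simp
qed

theorem proposition3p5:
  fixes n :: nat and a b :: complex
  assumes "n \<ge> 1"
    and "a + b \<notin> exceptional n"
  shows "hyp_poly n a b =
    ff_mult_conv n (hyp_poly n a (a + b)) (ff_add_conv n (ff_mult_unit n) (hyp_poly n a b))"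
proof -
  define x where "x = - a * of_nat n"
  define y where "y = (b - 1) * of_nat n"
  have yx: "(a + b - 1) * of_nat n = y - x"
    by (simp add: x_def y_def algebra_simps)
  have nz: "pochhammer (y - x) k \<noteq> 0" if "k \<le> n" for k
    using pochhammer_exceptional[OF that assms(2)] by (simp add: yx)
  have left: "hyp_poly n a (a + b) =
      poly_of_ecoeffs n (\<lambda>k. (- 1) ^ k * pochhammer x k / pochhammer (y - x) k)"
    using assms(2) unfolding hyp_poly_def hyp_poly_regular_def x_def[symmetric] yx by simp
  \<comment> \<open>Both convolutions act on normalized coefficients, so one scalar identity for
    each k suffices.\<close>
  have reduce: ?thesis
    if q: "hyp_poly n a b = poly_of_ecoeffs n e"
      and e: "\<And>k. k \<le> n \<Longrightarrow> e k = (- 1) ^ k * pochhammer x k / pochhammer (y - x) k *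
        (\<Sum>j\<le>k. of_nat (k choose j) * e j)" for e
    unfolding q left ff_add_conv_unit ff_mult_conv_poly_of_ecoeffs
    by (rule poly_of_ecoeffs_cong) (rule e)
  show ?thesis
  proof (cases "b \<in> exceptional n")
    case False
    show ?thesis
    proof (rule reduce)
      show "hyp_poly n a b =
          poly_of_ecoeffs n (\<lambda>k. (- 1) ^ k * pochhammer x k / pochhammer y k)"
        using False by (simp add: hyp_poly_def hyp_poly_regular_def x_def y_def)
      fix k assume k: "k \<le> n"
      have yk: "pochhammer y k \<noteq> 0"
        using pochhammer_exceptional[OF k False] by (simp add: y_def)
      show "(- 1) ^ k * pochhammer x k / pochhammer y k =
          (- 1) ^ k * pochhammer x k / pochhammer (y - x) k *
          (\<Sum>j\<le>k. of_nat (k choose j) * ((- 1) ^ j * pochhammer x j / pochhammer y j))"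
        unfolding binomial_transform_pochhammer_quotient[OF yk] using nz[OF k] by simp
    qed
  next
    case True
    then obtain i where i: "i \<in> {1..n}" and b: "b = 1 - (of_nat i - 1) / of_nat n"
      using assms(1) by (auto simp: exceptional_eq)
    have y: "y = 1 - of_nat i"
      using assms(1) by (simp add: y_def b)
    define f where "f = (\<lambda>k. if k < i then 0
      else (- 1) ^ k * pochhammer (of_nat i + x) (k - i) / fact (k - i) :: complex)"
    show ?thesis
    proof (rule reduce)
      show "hyp_poly n a b = poly_of_ecoeffs n (\<lambda>k. f k / of_nat (n choose i))"
        unfolding b hyp_poly_at_exceptional[OF assms(1) i] f_def x_def
        using i by (intro exceptional_family_eq_poly_of_ecoeffs) simp
      fix k assume k: "k \<le> n"
      have "f k = (- 1) ^ k * pochhammer x k / pochhammer (y - x) k *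
        (\<Sum>j\<le>k. of_nat (k choose j) * f j)"
      proof (cases "k < i")
        case True
        then show ?thesis
          by (simp add: f_def)
      next
        case False
        then have ik: "i \<le> k"
          by simp
        have den: "pochhammer (y - x) k =
            (- 1) ^ i * pochhammer x i * pochhammer (1 - x) (k - i)"
          unfolding y by (rule pochhammer_reflect_split[OF ik])
        have num: "pochhammer x k = pochhammer x i * pochhammer (of_nat i + x) (k - i)"
          using pochhammer_product[OF ik, of x] by (simp add: add.commute)
        \<comment> \<open>Regularity of a + b makes (y-x)_k nonzero, hence both of its factors. In
          particular (x)_i is nonzero and can be cancelled.\<close>
        have "pochhammer x i \<noteq> 0" "pochhammer (1 - x) (k - i) \<noteq> 0"
          using nz[OF k] by (auto simp: den)
        moreover have "(\<Sum>j\<le>k. of_nat (k choose j) * f j) =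
            (- 1) ^ i * pochhammer (1 - x) (k - i) / fact (k - i)"
          unfolding f_def by (rule binomial_transform_shifted_pochhammer[OF ik])
        ultimately show ?thesis
          using False by (simp add: den num f_def)
      qed
      \<comment> \<open>The identity is linear in the coefficients, so the constant normalization
        1/(n choose i) passes through.\<close>
      then show "f k / of_nat (n choose i) =
          (- 1) ^ k * pochhammer x k / pochhammer (y - x) k *
          (\<Sum>j\<le>k. of_nat (k choose j) * (f j / of_nat (n choose i)))"
        by (simp flip: sum_divide_distrib)
    qed
  qed
qed

end
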